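(* Let $Y$ be a nonempty set and let $X$ be a subset of a Hausdorff topological vector space which is invariant under infinite convex combinations. Let $H,L: X\times Y\to\mathbb{R}$ be two mappings such that: (i) $H$ is bounded on $X\times Y$; for every $y\in Y$ the function $H(\cdot,y): X\to\mathbb{R}$ is convex; $H(\lambda x,y)=\lambda H(x,y)$ whenever $\lambda>0$, $x\in X$, $\lambda x\in X$ and $y\in Y$; and, moreover, for every $x\in X$ there exists $y_x\in Y$ satisfying $$H(x,y_x)=\sup_{y\in Y} H(x,y);$$ (ii) $\overline{\mathrm{span}}\{H(\cdot,y): y\in Y\}$ is a separable subspace of $\ell^\infty(X)$; (iii) $L$ is supinf-concave on $Y$; (iv) $H\leq L$ on $X\times Y$. Then $$\inf_{x\in X}\sup_{y\in Y} H(x,y)\leq\sup_{y\in Y}\inf_{x\in X} L(x,y).$$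
   Context: A subset $X$ of a Hausdorff (real) topological vector space is invariant under infinite convex combinations if for every sequence $(x_n)_{n\geq1}\subset X$ and every sequence $\lambda_n\geq0$ with $\sum_{n=1}^\infty\lambda_n=1$, the series $\sum_{n=1}^\infty\lambda_n x_n$ converges to an element of $X$. $\ell^\infty(X)$ is the Banach space of all bounded real-valued functions on $X$ with the supremum norm, and $\overline{\mathrm{span}}$ is the norm-closed linear span. For $n\ge 1$, $\Delta_n=\{(\lambda_1,\dots,\lambda_n)\in\mathbb{R}_+^n:\sum_{i=1}^n\lambda_i=1\}$. $L$ is supinf-concave on $Y$ if $$\sup_{y\in Y}\inf_{x\in X} L(x,y)=\sup_{n\geq 1,\ y_1,\dots,y_n\in Y,\ (\lambda_1,\dots,\lambda_n)\in\Delta_n}\ \inf_{x\in X}\sum_{i=1}^n\lambda_i L(x,y_i).$$ Infima and suprema are taken in the extended reals. *)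

theory Defs
  imports "HOL-Analysis.Analysis"
begin

text \<open>The Hausdorff axiom is not part of this class; add the sort \<^class>\<open>t2_space\<close> where needed.\<close>

class topological_real_vector = real_vector + topological_ab_group_add +
  assumes tendsto_scaleR_Pair:
    "LIM p (nhds a \<times>\<^sub>F nhds x). fst p *\<^sub>R snd p :> nhds (a *\<^sub>R x)"

instance real_normed_vector \<subseteq> topological_real_vector
proof
  fix a :: real and x :: 'a
  show "LIM p (nhds a \<times>\<^sub>F nhds x). fst p *\<^sub>R snd p :> nhds (a *\<^sub>R x)"
    unfolding nhds_prod[symmetric]
    using tendsto_scaleR[OF tendsto_fst[OF filterlim_ident] tendsto_snd[OF filterlim_ident],
      of "(a, x)"] by simp
qed

definition invariant_infinite_convex_combinations ::
    "'v::topological_real_vector set \<Rightarrow> bool" where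
  "invariant_infinite_convex_combinations X \<longleftrightarrow>
    (\<forall>(x::nat \<Rightarrow> 'v) (l::nat \<Rightarrow> real).
       (\<forall>n. x n \<in> X) \<and> (\<forall>n. 0 \<le> l n) \<and> l sums 1 \<longrightarrow>
       (\<exists>s\<in>X. (\<lambda>n. l n *\<^sub>R x n) sums s))"

text \<open>Points of \<open>linf X\<close> are the functions that are bounded on \<open>X\<close> and take the value
  \<^const>\<open>undefined\<close> outside \<open>X\<close>, with the supremum distance; hence the restrictions to \<open>X\<close> below.\<close>

definition linf :: "'a set \<Rightarrow> ('a \<Rightarrow> real) metric" where
  "linf X = funspace X euclidean_metric"

definition linf_span :: "'a set \<Rightarrow> ('a \<Rightarrow> real) set \<Rightarrow> ('a \<Rightarrow> real) set" where
  "linf_span X S = {(\<lambda>x\<in>X. \<Sum>f\<in>F. c f * f x) | F c. finite F \<and> F \<subseteq> S}"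

definition linf_closed_span :: "'a set \<Rightarrow> ('a \<Rightarrow> real) set \<Rightarrow> ('a \<Rightarrow> real) set" where
  "linf_closed_span X S = mtopology_of (linf X) closure_of linf_span X S"

definition std_simplex :: "nat \<Rightarrow> (nat \<Rightarrow> real) set" where
  "std_simplex n = {l \<in> {1..n} \<rightarrow>\<^sub>E {0..}. (\<Sum>i=1..n. l i) = 1}"

text \<open>All infima and suprema are taken in \<^typ>\<open>ereal\<close>.\<close>

definition supinf_concave :: "'a set \<Rightarrow> 'b set \<Rightarrow> ('a \<Rightarrow> 'b \<Rightarrow> real) \<Rightarrow> bool" where
  "supinf_concave X Y L \<longleftrightarrow>
    (SUP y\<in>Y. INF x\<in>X. ereal (L x y)) =
    (SUP (n, y, l) \<in> (SIGMA n:{1::nat..}. ({1..n} \<rightarrow>\<^sub>E Y) \<times> std_simplex n).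
       INF x\<in>X. ereal (\<Sum>i=1..n. l i * L x (y i)))"

end

theory Submission
  imports Defs
begin

text \<open>Suppose \<open>c\<close> lies strictly between the two sides. Separability gives a sequence \<open>d i\<close> in \<open>Y\<close>
  such that the functions \<open>H (\<cdot>, d i)\<close> are uniformly dense among all \<open>H (\<cdot>, y)\<close>. The sets
  \<open>C n = {x \<in> X. H (x, d i) \<le> c for 1 \<le> i \<le> n}\<close> are nonempty by the finite convex alternative,
  supinf-concavity of \<open>L\<close> and \<open>H \<le> L\<close>, and they inherit invariance under infinite convex
  combinations. Simons' inequality, applied to these sets following Oja's proof, yields \<open>v \<in> X\<close>
  and \<open>y \<in> Y\<close> attaining \<open>sup H (v, \<cdot>)\<close> such that every \<open>C n\<close> contains a point \<open>w\<close> with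
  \<open>H (w, y)\<close> almost as large as \<open>H (v, y)\<close>; but \<open>H (\<cdot>, y)\<close> is at most about \<open>c\<close> on \<open>C n\<close> for
  large \<open>n\<close>.\<close>

section \<open>Infinite convex combinations and convex functions\<close>

lemma tendsto_scaleR_const:
  fixes f :: "'b \<Rightarrow> 'v::topological_real_vector"
  assumes "(f \<longlongrightarrow> s) F"
  shows "((\<lambda>n. c *\<^sub>R f n) \<longlongrightarrow> c *\<^sub>R s) F"
  using filterlim_compose[OF tendsto_scaleR_Pair filterlim_Pair[OF tendsto_const assms]]
  by simp

lemma sums_scaleR_const:
  fixes f :: "nat \<Rightarrow> 'v::topological_real_vector"
  assumes "f sums s"
  shows "(\<lambda>n. c *\<^sub>R f n) sums (c *\<^sub>R s)"
  using tendsto_scaleR_const[OF assms[unfolded sums_def]]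
  unfolding sums_def by (simp add: scaleR_sum_right)

lemma sums_drop_initial_segment:
  fixes f :: "nat \<Rightarrow> 'a::topological_ab_group_add"
  assumes "f sums s"
  shows "(\<lambda>n. f (n + k)) sums (s - (\<Sum>i<k. f i))"
proof -
  have "(\<Sum>i<n. f (i + k)) = (\<Sum>i<n + k. f i) - (\<Sum>i<k. f i)" for n
    by (induction n) (simp_all add: algebra_simps)
  then show ?thesis
    using tendsto_diff[OF LIMSEQ_ignore_initial_segment[OF assms[unfolded sums_def], of k] tendsto_const]
    unfolding sums_def by simp
qed

text \<open>The tail, renormalised to total weight 1, is itself an infinite convex combination, so
  its sum is a point of \<open>X\<close>. This turns an infinite combination into a finite
  one.\<close>

lemma invariant_tail:
  fixes x :: "nat \<Rightarrow> 'v::{topological_real_vector, t2_space}"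
  assumes X: "invariant_infinite_convex_combinations X"
    and x: "\<And>n. x n \<in> X" and l: "\<And>n. 0 \<le> l n" "l sums 1"
    and s: "(\<lambda>n. l n *\<^sub>R x n) sums s"
  obtains t where "t \<in> X" "s = (\<Sum>i<N. l i *\<^sub>R x i) + (1 - (\<Sum>i<N. l i)) *\<^sub>R t"
proof -
  define r where "r = 1 - (\<Sum>i<N. l i)"
  have lr: "(\<lambda>n. l (n + N)) sums r"
    unfolding r_def by (rule sums_drop_initial_segment[OF l(2)])
  have s': "(\<lambda>n. l (n + N) *\<^sub>R x (n + N)) sums (s - (\<Sum>i<N. l i *\<^sub>R x i))"
    by (rule sums_drop_initial_segment[OF s])
  have "\<exists>t\<in>X. s - (\<Sum>i<N. l i *\<^sub>R x i) = r *\<^sub>R t"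
  proof (cases "r = 0")
    \<comment> \<open>The tail cannot be renormalised here, but all its weights vanish, so any point
      of \<open>X\<close> serves as \<open>t\<close>.\<close>
    case True
    have "l (n + N) = 0" for n
      using suminf_eq_zero_iff[OF sums_summable[OF lr]] sums_unique[OF lr] True l(1) by simp
    then have "(\<lambda>n. l (n + N) *\<^sub>R x (n + N)) sums 0"
      by simp
    then have "s - (\<Sum>i<N. l i *\<^sub>R x i) = 0"
      using s' sums_unique2 by blast
    then show ?thesis
      using True x by auto
  next
    case False
    moreover have "r \<ge> 0"
      using sums_le[OF _ sums_zero lr] l(1) by simp
    ultimately have "r > 0"
      by simp
    then have "(\<lambda>n. l (n + N) / r) sums 1"
      using sums_divide[OF lr, of r] by simp
    then obtain t where t: "t \<in> X" "(\<lambda>n. (l (n + N) / r) *\<^sub>R x (n + N)) sums t"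
      using X[unfolded invariant_infinite_convex_combinations_def, rule_format,
          of "\<lambda>n. x (n + N)" "\<lambda>n. l (n + N) / r"] x l(1) \<open>r > 0\<close> by auto
    have "(\<lambda>n. l (n + N) *\<^sub>R x (n + N)) sums (r *\<^sub>R t)"
      using sums_scaleR_const[OF t(2), of r] \<open>r > 0\<close> by simp
    then show ?thesis
      using s' sums_unique2 t(1) by blast
  qed
  then show thesis
    using that unfolding r_def by (metis add.commute diff_add_cancel)
qed

text \<open>Since \<open>h\<close> need not be continuous, no limit can be taken inside it. Instead
  the tail is collapsed into one point of \<open>X\<close>, finite Jensen applies, and the tail
  contributes at most its weight times \<open>M\<close>, which tends to 0.\<close>

lemma convex_on_sums_le:
  fixes x :: "nat \<Rightarrow> 'v::{topological_real_vector, t2_space}"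
  assumes X: "invariant_infinite_convex_combinations X"
    and h: "convex_on X h" "\<And>x. x \<in> X \<Longrightarrow> h x \<le> M"
    and x: "\<And>n. x n \<in> X" "\<And>n. h (x n) \<le> c"
    and l: "\<And>n. 0 \<le> l n" "l sums 1"
    and s: "(\<lambda>n. l n *\<^sub>R x n) sums s"
  shows "h s \<le> c"
proof -
  have bound: "h s \<le> (\<Sum>i<N. l i) * c + (1 - (\<Sum>i<N. l i)) * M" for N
  proof -
    define r where "r = 1 - (\<Sum>i<N. l i)"
    have "r \<ge> 0"
      unfolding r_def using sum_le_suminf[OF sums_summable[OF l(2)], of "{..<N}"] l sums_unique[OF l(2), symmetric]
      by simp
    obtain t where t: "t \<in> X" "s = (\<Sum>i<N. l i *\<^sub>R x i) + r *\<^sub>R t"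
      using invariant_tail[OF X x(1) l s] unfolding r_def by blast
    \<comment> \<open>Slot \<open>N\<close> carries the collapsed tail, so that Jensen's inequality
      runs over \<open>{..N}\<close>.\<close>
    define a where "a = l(N := r)"
    define y where "y = x(N := t)"
    have *: "(\<Sum>i\<le>N. f (a i) (y i)) = (\<Sum>i<N. f (l i) (x i)) + f r t" for f :: "real \<Rightarrow> 'v \<Rightarrow> 'c::ab_group_add"
      by (simp add: a_def y_def flip: lessThan_Suc_atMost)
    have "h s = h (\<Sum>i\<le>N. a i *\<^sub>R y i)"
      using *[of scaleR] t(2) by simp
    also have "\<dots> \<le> (\<Sum>i\<le>N. a i * h (y i))"
      using *[of "\<lambda>u _. u"] l(1) x(1) t(1) \<open>r \<ge> 0\<close>
      by (intro convex_on_sum[OF _ _ h(1)]) (auto simp: a_def y_def r_def)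
    also have "\<dots> = (\<Sum>i<N. l i * h (x i)) + r * h t"
      using *[of "\<lambda>u v. u * h v"] by simp
    also have "\<dots> \<le> (\<Sum>i<N. l i * c) + r * M"
      using l(1) x(2) h(2)[OF t(1)] \<open>r \<ge> 0\<close> by (intro add_mono sum_mono mult_left_mono) auto
    finally show ?thesis
      by (simp add: sum_distrib_right r_def)
  qed
  have "(\<lambda>N. (\<Sum>i<N. l i) * c + (1 - (\<Sum>i<N. l i)) * M) \<longlonglongrightarrow> 1 * c + (1 - 1) * M"
    using l(2) unfolding sums_def by (intro tendsto_intros)
  then have "(\<lambda>N. (\<Sum>i<N. l i) * c + (1 - (\<Sum>i<N. l i)) * M) \<longlonglongrightarrow> c"
    by simp
  then show ?thesis
    by (rule LIMSEQ_le_const) (use bound in blast)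
qed

lemma invariant_convex_sublevel:
  fixes X :: "'v::{topological_real_vector, t2_space} set"
  assumes X: "invariant_infinite_convex_combinations X"
    and h: "\<And>i. i \<in> I \<Longrightarrow> convex_on X (h i)" "\<And>i x. i \<in> I \<Longrightarrow> x \<in> X \<Longrightarrow> h i x \<le> M"
  shows "invariant_infinite_convex_combinations {x \<in> X. \<forall>i\<in>I. h i x \<le> c}"
  unfolding invariant_infinite_convex_combinations_def
proof (intro allI impI)
  fix x :: "nat \<Rightarrow> 'v" and l :: "nat \<Rightarrow> real"
  assume *: "(\<forall>n. x n \<in> {x \<in> X. \<forall>i\<in>I. h i x \<le> c}) \<and> (\<forall>n. 0 \<le> l n) \<and> l sums 1"
  then obtain s where s: "s \<in> X" "(\<lambda>n. l n *\<^sub>R x n) sums s"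
    using X unfolding invariant_infinite_convex_combinations_def by blast
  have "h i s \<le> c" if "i \<in> I" for i
    using * that by (intro convex_on_sums_le[OF X h(1)[OF that] h(2)[OF that] _ _ _ _ s(2)]) auto
  with s show "\<exists>s\<in>{x \<in> X. \<forall>i\<in>I. h i x \<le> c}. (\<lambda>n. l n *\<^sub>R x n) sums s"
    by blast
qed

section \<open>Simons' inequality\<close>

lemma ex_approx_minimizer:
  fixes g :: "'a \<Rightarrow> real"
  assumes "C \<noteq> {}" "bdd_below (g ` C)" "\<delta> > 0"
  shows "\<exists>z\<in>C. \<forall>z'\<in>C. g z \<le> g z' + \<delta>"
proof -
  have "Inf (g ` C) < Inf (g ` C) + \<delta>"
    using assms(3) by simp
  then obtain z where "z \<in> C" "g z < Inf (g ` C) + \<delta>"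
    using cInf_lessD[of "g ` C"] assms(1) by blast
  moreover have "Inf (g ` C) \<le> g z'" if "z' \<in> C" for z'
    using assms(2) that by (simp add: cInf_lower)
  ultimately show ?thesis
    by (intro bexI[of _ z] ballI) force+
qed

text \<open>The point \<open>w \<in> C n\<close> is the tail average of \<open>v = \<Sum>j. (1/2) ^ Suc j *\<^sub>R z j\<close>, and \<open>u n\<close> is the
  average of its first \<open>n\<close> terms: \<open>2 ^ n *\<^sub>R v = (2 ^ n - 1) *\<^sub>R u n + w n\<close>. Each \<open>z n\<close> almost
  minimizes \<open>p\<close> at the next average, and comparing it with the competitor \<open>w n\<close> telescopes to
  \<open>p (u n) \<le> p v\<close> up to an error small enough that \<open>H (w n) y\<close> must nearly reach \<open>p v\<close>.\<close>

lemma simons_inequality: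
  fixes X :: "'v::{topological_real_vector, t2_space} set" and H :: "'v \<Rightarrow> 'y \<Rightarrow> real"
  assumes Y: "Y \<noteq> {}" and X: "X \<noteq> {}"
    and convex: "\<And>y. y \<in> Y \<Longrightarrow> convex_on X (\<lambda>x. H x y)"
    and bounded: "\<And>x y. x \<in> X \<Longrightarrow> y \<in> Y \<Longrightarrow> \<bar>H x y\<bar> \<le> M"
    and attains: "\<And>x. x \<in> X \<Longrightarrow> \<exists>y\<in>Y. \<forall>y'\<in>Y. H x y' \<le> H x y"
    and C: "\<And>n. invariant_infinite_convex_combinations (C n)"
    and C_sub: "\<And>n. C n \<subseteq> X" and C_nonempty: "\<And>n. C n \<noteq> {}" and decC: "decseq C"
    and \<epsilon>: "\<epsilon> > 0"
  obtains v y where "v \<in> X" "y \<in> Y" "\<And>y'. y' \<in> Y \<Longrightarrow> H v y' \<le> H v y"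
    "\<And>n. \<exists>w\<in>C n. H v y \<le> H w y + \<epsilon>"
proof -
  obtain b where b: "\<And>x. x \<in> X \<Longrightarrow> b x \<in> Y" "\<And>x y. x \<in> X \<Longrightarrow> y \<in> Y \<Longrightarrow> H x y \<le> H x (b x)"
    using attains by metis
  define p where "p x = H x (b x)" for x
  have convX: "convex X"
    using Y convex convex_on_imp_convex by blast
  have p_convex: "convex_on X p"
    unfolding convex_on_alt
  proof (intro conjI ballI allI impI convX)
    fix x y and \<mu> :: real assume xy: "x \<in> X" "y \<in> X" and \<mu>: "0 \<le> \<mu> \<and> \<mu> \<le> 1"
    let ?z = "\<mu> *\<^sub>R x + (1 - \<mu>) *\<^sub>R y"
    have z: "?z \<in> X"
      using convX xy \<mu> by (simp add: convexD)
    have "p ?z \<le> \<mu> * H x (b ?z) + (1 - \<mu>) * H y (b ?z)"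
      using convex[OF b(1)[OF z]] xy \<mu> unfolding convex_on_alt p_def by blast
    also have "\<dots> \<le> \<mu> * p x + (1 - \<mu>) * p y"
      unfolding p_def using b xy z \<mu> by (intro add_mono mult_left_mono) auto
    finally show "p ?z \<le> \<mu> * p x + (1 - \<mu>) * p y" .
  qed
  have p_lower: "- M \<le> p x" if "x \<in> X" for x
    using bounded[OF that b(1)[OF that]] unfolding p_def by auto
  \<comment> \<open>\<open>\<theta> n\<close> is the share of the weight
    \<open>(1/2) ^ Suc n\<close> in the sum \<open>1 - (1/2) ^ Suc n\<close> of the first
    \<open>Suc n\<close> weights. The tolerance \<open>\<delta> n\<close> is such that multiplying
    by \<open>2 * 2 ^ n - 1\<close> leaves \<open>\<epsilon> * (1/2) ^ Suc n\<close>, with total at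
    most \<open>\<epsilon>\<close>.\<close>
  define \<theta> :: "nat \<Rightarrow> real" where "\<theta> n = 1 / (2 * 2 ^ n - 1)" for n
  define \<delta> :: "nat \<Rightarrow> real" where "\<delta> n = \<epsilon> * (1/2) ^ Suc n * \<theta> n" for n
  have N1: "(1::real) \<le> 2 ^ n" for n
    by simp
  have \<theta>: "0 < \<theta> n" "\<theta> n \<le> 1" for n
    using N1[of n] unfolding \<theta>_def by (smt (verit) divide_le_eq_1_pos zero_less_divide_1_iff)+
  have N\<theta>: "(2 * 2 ^ n - 1) * \<theta> n = 1" "(2 * 2 ^ n - 1) * (1 - \<theta> n) = 2 * (2 ^ n - 1)" for n
  proof -
    show "(2 * 2 ^ n - 1) * \<theta> n = 1"
      using N1[of n] unfolding \<theta>_def by (smt (verit) nonzero_mult_div_cancel_left times_divide_eq_right mult_1_right)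
    then show "(2 * 2 ^ n - 1) * (1 - \<theta> n) = 2 * (2 ^ n - 1)"
      by (simp add: algebra_simps)
  qed
  have ex: "\<exists>z\<in>C n. \<forall>z'\<in>C n. p ((1 - \<theta> n) *\<^sub>R u + \<theta> n *\<^sub>R z) \<le> p ((1 - \<theta> n) *\<^sub>R u + \<theta> n *\<^sub>R z') + \<delta> n"
    if "u \<in> X" for n u
  proof (rule ex_approx_minimizer[OF C_nonempty])
    show "\<delta> n > 0"
      using \<epsilon> \<theta> by (simp add: \<delta>_def)
    show "bdd_below ((\<lambda>z. p ((1 - \<theta> n) *\<^sub>R u + \<theta> n *\<^sub>R z)) ` C n)"
      using that C_sub \<theta>[of n] convX
      by (intro bdd_belowI2[of _ "- M"] p_lower convexD) auto
  qed
  define f where "f n u = (SOME z. z \<in> C n \<and> (\<forall>z'\<in>C n.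
      p ((1 - \<theta> n) *\<^sub>R u + \<theta> n *\<^sub>R z) \<le> p ((1 - \<theta> n) *\<^sub>R u + \<theta> n *\<^sub>R z') + \<delta> n))" for n u
  have f: "f n u \<in> C n"
    "\<And>z'. z' \<in> C n \<Longrightarrow>
      p ((1 - \<theta> n) *\<^sub>R u + \<theta> n *\<^sub>R f n u) \<le> p ((1 - \<theta> n) *\<^sub>R u + \<theta> n *\<^sub>R z') + \<delta> n"
    if "u \<in> X" for n u
    using someI_ex[OF ex[OF that, unfolded Bex_def]] unfolding f_def by blast+
  obtain x0 where x0: "x0 \<in> X"
    using X by blast
  \<comment> \<open>As \<open>\<theta> 0 = 1\<close>, the arbitrary seed \<open>x0\<close> has
    coefficient 0 in \<open>u 1\<close>.\<close>
  define u where "u = rec_nat x0 (\<lambda>n u. (1 - \<theta> n) *\<^sub>R u + \<theta> n *\<^sub>R f n u)"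
  define z where "z n = f n (u n)" for n
  have u_Suc: "u (Suc n) = (1 - \<theta> n) *\<^sub>R u n + \<theta> n *\<^sub>R z n" for n
    by (simp add: u_def z_def)
  have uX: "u n \<in> X" for n
  proof (induction n)
    case 0 show ?case using x0 by (simp add: u_def)
  next
    case (Suc n)
    then show ?case
      unfolding u_Suc using f(1)[OF Suc, of n] C_sub[of n] \<theta>[of n] convX
      by (intro convexD) (auto simp: z_def)
  qed
  have zC: "z n \<in> C n" for n
    using f(1) uX by (simp add: z_def)
  have z_min: "p (u (Suc n)) \<le> p ((1 - \<theta> n) *\<^sub>R u n + \<theta> n *\<^sub>R z') + \<delta> n" if "z' \<in> C n" for n z'
    unfolding u_Suc z_def using f(2) uX that by blast
  have "\<exists>w\<in>C n. (\<lambda>j. (1/2) ^ Suc j *\<^sub>R z (j + n)) sums w" for n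
  proof -
    \<comment> \<open>Because \<open>C\<close> decreases, the whole shifted sequence stays in
      \<open>C n\<close>, and so does its infinite combination.\<close>
    have "z (j + n) \<in> C n" for j
      using zC[of "j + n"] decseqD[OF decC le_add2] by blast
    then show ?thesis
      using C[of n, unfolded invariant_infinite_convex_combinations_def, rule_format,
          of "\<lambda>j. z (j + n)" "\<lambda>j. (1/2) ^ Suc j"] power_half_series by simp
  qed
  then obtain w where w: "\<And>n. w n \<in> C n" "\<And>n. (\<lambda>j. (1/2) ^ Suc j *\<^sub>R z (j + n)) sums w n"
    by metis
  have w_rec: "2 *\<^sub>R w n = z n + w (Suc n)" for n
  proof -
    have "(\<lambda>j. 2 *\<^sub>R ((1/2) ^ Suc (j + 1) *\<^sub>R z (j + 1 + n))) sums (2 *\<^sub>R (w n - (1/2) *\<^sub>R z n))"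
      using sums_scaleR_const[OF sums_drop_initial_segment[OF w(2)[of n], of 1], of 2] by simp
    then have "(\<lambda>j. (1/2) ^ Suc j *\<^sub>R z (j + Suc n)) sums (2 *\<^sub>R (w n - (1/2) *\<^sub>R z n))"
      by simp
    then have "w (Suc n) = 2 *\<^sub>R (w n - (1/2) *\<^sub>R z n)"
      using w(2)[of "Suc n"] sums_unique2 by blast
    then show ?thesis
      by (simp add: algebra_simps)
  qed
  define v where "v = w 0"
  have v_eq: "(2 ^ n) *\<^sub>R v = (2 ^ n - 1) *\<^sub>R u n + w n" for n
  proof (induction n)
    case 0 show ?case by (simp add: v_def)
  next
    case (Suc n)
    have "(2 ^ Suc n) *\<^sub>R v = 2 *\<^sub>R ((2 ^ n) *\<^sub>R v)"
      by simp
    also have "\<dots> = (2 * (2 ^ n - 1)) *\<^sub>R u n + 2 *\<^sub>R w n"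
      unfolding Suc.IH by (simp add: scaleR_add_right)
    also have "\<dots> = ((2 * 2 ^ n - 1) * (1 - \<theta> n)) *\<^sub>R u n + ((2 * 2 ^ n - 1) * \<theta> n) *\<^sub>R z n + w (Suc n)"
      unfolding w_rec N\<theta> by simp
    also have "\<dots> = (2 ^ Suc n - 1) *\<^sub>R u (Suc n) + w (Suc n)"
      unfolding u_Suc by (simp add: scaleR_add_right)
    finally show ?case .
  qed
  have vX: "v \<in> X"
    using w(1)[of 0] C_sub by (auto simp: v_def)
  \<comment> \<open>The competitor \<open>w n\<close> moves \<open>u n\<close> to a point of the
    segment from \<open>u n\<close> to \<open>v\<close>, with weight \<open>\<mu>\<close> on
    \<open>u n\<close>. Convexity of \<open>p\<close> then brings in \<open>p v\<close>.\<close>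
  have step: "(2 * 2 ^ n - 1) * p (u (Suc n)) \<le> (2 ^ n - 1) * p (u n) + 2 ^ n * p v + \<epsilon> * (1/2) ^ Suc n" for n
  proof -
    let ?N = "2 ^ n :: real"
    define \<mu> where "\<mu> = (?N - 1) * \<theta> n"
    have D: "2 * ?N - 1 > 0"
      using N1[of n] by linarith
    have \<mu>: "0 \<le> \<mu>" "\<mu> \<le> 1" "1 - \<mu> = ?N * \<theta> n" "1 - \<theta> n = 2 * \<mu>"
      using N1[of n] D by (auto simp: \<mu>_def \<theta>_def field_simps)
    have "(1 - \<theta> n) *\<^sub>R u n + \<theta> n *\<^sub>R w n = \<mu> *\<^sub>R u n + \<theta> n *\<^sub>R ((?N - 1) *\<^sub>R u n + w n)"
      unfolding \<mu>(4) by (simp add: \<mu>_def scaleR_add_right mult.commute flip: scaleR_add_left)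
    also have "\<dots> = \<mu> *\<^sub>R u n + (1 - \<mu>) *\<^sub>R v"
      unfolding v_eq[symmetric] \<mu>(3) by (simp add: mult.commute)
    finally have "p (u (Suc n)) \<le> p (\<mu> *\<^sub>R u n + (1 - \<mu>) *\<^sub>R v) + \<delta> n"
      using z_min[OF w(1)] by metis
    also have "\<dots> \<le> \<mu> * p (u n) + (1 - \<mu>) * p v + \<delta> n"
      using p_convex uX vX \<mu>(1,2) unfolding convex_on_alt by simp
    finally have "(2 * ?N - 1) * p (u (Suc n)) \<le> (2 * ?N - 1) * (\<mu> * p (u n) + (1 - \<mu>) * p v + \<delta> n)"
      using D by simp
    also have "\<dots> = ((2 * ?N - 1) * \<mu>) * p (u n) + ((2 * ?N - 1) * (1 - \<mu>)) * p v + (2 * ?N - 1) * \<delta> n"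
      by (simp add: algebra_simps)
    also have "(2 * ?N - 1) * \<mu> = ?N - 1"
      using D by (simp add: \<mu>_def \<theta>_def)
    also have "(2 * ?N - 1) * (1 - \<mu>) = ?N"
      using D by (simp add: \<mu>(3) \<theta>_def)
    also have "(2 * ?N - 1) * \<delta> n = ((2 * ?N - 1) * \<theta> n) * (\<epsilon> * (1/2) ^ Suc n)"
      by (simp only: \<delta>_def mult_ac)
    also have "\<dots> = \<epsilon> * (1/2) ^ Suc n"
      unfolding N\<theta> by simp
    finally show ?thesis .
  qed
  have telescope: "(2 ^ n - 1) * p (u n) \<le> (2 ^ n - 1) * p v + \<epsilon> * (1 - (1/2) ^ n)" for n
  proof (induction n)
    case (Suc n)
    then show ?case
      using step[of n] by (simp add: algebra_simps)
  qed simp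
  \<comment> \<open>In \<open>v\<close> the point \<open>w n\<close> has only weight
    \<open>1 / 2 ^ n\<close>. After scaling by \<open>2 ^ n\<close>, the bound in
    \<open>telescope\<close> cancels all but one copy of \<open>p v\<close> while its error stays
    below \<open>\<epsilon>\<close>, uniformly in \<open>n\<close>.\<close>
  have final: "H v (b v) \<le> H (w n) (b v) + \<epsilon>" for n
  proof -
    let ?N = "2 ^ n :: real"
    let ?h = "\<lambda>x. H x (b v)"
    have wX: "w n \<in> X"
      using w(1) C_sub by blast
    have "v = (1 / ?N) *\<^sub>R (?N *\<^sub>R v)"
      by simp
    also have "\<dots> = (1 - 1 / ?N) *\<^sub>R u n + (1 / ?N) *\<^sub>R w n"
      unfolding v_eq by (simp add: scaleR_add_right diff_divide_distrib)
    finally have "?h v \<le> (1 - 1 / ?N) * ?h (u n) + (1 / ?N) * ?h (w n)"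
      using convex_onD[OF convex[OF b(1)[OF vX]] _ _ uX wX, of "1 / ?N" n] N1[of n] by simp
    then have "?N * ?h v \<le> ?N * ((1 - 1 / ?N) * ?h (u n) + (1 / ?N) * ?h (w n))"
      by simp
    also have "\<dots> = (?N - 1) * ?h (u n) + ?h (w n)"
      by (simp add: field_simps)
    also have "\<dots> \<le> (?N - 1) * p (u n) + ?h (w n)"
      unfolding p_def using b uX vX N1[of n] by (intro add_mono mult_left_mono) auto
    also have "\<dots> \<le> (?N - 1) * p v + \<epsilon> * (1 - (1/2) ^ n) + ?h (w n)"
      using telescope by simp
    also have "\<dots> \<le> (?N - 1) * p v + \<epsilon> + ?h (w n)"
      using \<epsilon> by (simp add: algebra_simps)
    finally show ?thesis
      by (simp add: p_def algebra_simps)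
  qed
  show thesis
    using that[OF vX b(1)[OF vX] b(2)[OF vX]] final w(1) by blast
qed

section \<open>The finite convex alternative\<close>

lemma convex_on_weighted_sum:
  assumes "convex X" "finite I" "\<And>i. i \<in> I \<Longrightarrow> convex_on X (f i)" "\<And>i. i \<in> I \<Longrightarrow> (0::real) \<le> l i"
  shows "convex_on X (\<lambda>x. \<Sum>i\<in>I. l i * f i x)"
  using assms(2-) by (induction I) (auto simp: convex_on_const assms(1) intro!: convex_on_add convex_on_cmul)

text \<open>A negative slope would make the affine function negative for large \<open>r\<close>.
  This fixes the signs of the coefficients of a separating functional.\<close>

lemma slope_nonneg:
  fixes a K :: real
  assumes "\<And>r. r > 0 \<Longrightarrow> 0 \<le> a * r + K"
  shows "a \<ge> 0"
proof (rule ccontr)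
  assume "\<not> a \<ge> 0"
  then have "a < 0" by simp
  then have "(\<bar>K\<bar> + 1) / (- a) > 0"
    by (intro divide_pos_pos) auto
  from assms[OF this] have "0 \<le> K - (\<bar>K\<bar> + 1)"
    using \<open>a < 0\<close> by simp
  then show False by simp
qed

text \<open>The pairs strictly above some \<open>(f x, g x)\<close> form a convex subset of the
  plane that misses the origin. A separating functional has nonnegative coefficients because this
  set is closed upwards; normalising them gives the weights.\<close>

lemma convex_alternative_pair:
  assumes f: "convex_on X f" and g: "convex_on X g"
    and none: "\<And>x. x \<in> X \<Longrightarrow> f x \<ge> 0 \<or> g x \<ge> 0"
  shows "\<exists>a\<ge>0. \<exists>b\<ge>0. a + b = 1 \<and> (\<forall>x\<in>X. 0 \<le> a * f x + b * (g x :: real))"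
proof (cases "X = {}")
  case True
  then show ?thesis by (intro exI[of _ 1] conjI exI[of _ 0]) auto
next
  case False
  define K where "K = {(s, t). \<exists>x\<in>X. f x < s \<and> g x < t}"
  have "convex K"
  proof (rule convexI, clarsimp simp: K_def)
    fix s t s' t' u v :: real and x y
    assume uv: "0 \<le> u" "0 \<le> v" "u + v = 1" and x: "x \<in> X" "f x < s" "g x < t"
      and y: "y \<in> X" "f y < s'" "g y < t'"
    \<comment> \<open>A zero weight destroys strictness in its own term, hence the split on
      \<open>u\<close>.\<close>
    have strict: "u * a + v * b < u * a' + v * b'" if "a < a'" "b < b'" for a b a' b' :: real
    proof (cases "u = 0")
      case False
      with uv that have "u * a < u * a'" "v * b \<le> v * b'"
        by (auto intro: mult_left_mono)
      then show ?thesis by linarith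
    qed (use uv that in simp)
    have "u *\<^sub>R x + v *\<^sub>R y \<in> X"
      using convex_on_imp_convex[OF f] uv x y by (simp add: convexD)
    moreover have "f (u *\<^sub>R x + v *\<^sub>R y) \<le> u * f x + v * f y" "g (u *\<^sub>R x + v *\<^sub>R y) \<le> u * g x + v * g y"
      using f g uv x y unfolding convex_on_def by auto
    ultimately show "\<exists>z\<in>X. f z < u * s + v * s' \<and> g z < u * t + v * t'"
      using strict x y by (meson le_less_trans)
  qed
  moreover have "0 \<notin> K"
    using none by (fastforce simp: K_def zero_prod_def)
  ultimately obtain c where c: "c \<noteq> 0" "\<And>k. k \<in> K \<Longrightarrow> 0 \<le> inner c k"
    using separating_hyperplane_set_0 by metis
  obtain a b where ab: "c = (a, b)"
    by fastforce
  have sep: "0 \<le> a * (f x + r) + b * (g x + q)" if "x \<in> X" "r > 0" "q > 0" for x r q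
  proof -
    have "(f x + r, g x + q) \<in> K"
      using that unfolding K_def by force
    from c(2)[OF this] show ?thesis
      by (simp add: ab)
  qed
  obtain x0 where x0: "x0 \<in> X"
    using False by blast
  have "a \<ge> 0"
    using sep[OF x0 _ zero_less_one] by (intro slope_nonneg[of a "a * f x0 + b * (g x0 + 1)"])
      (simp add: algebra_simps)
  have "b \<ge> 0"
    using sep[OF x0 zero_less_one] by (intro slope_nonneg[of b "a * (f x0 + 1) + b * g x0"])
      (simp add: algebra_simps)
  have pos: "a + b > 0"
    using \<open>a \<ge> 0\<close> \<open>b \<ge> 0\<close> c(1) ab by (auto simp: zero_prod_def)
  have nonneg: "0 \<le> a * f x + b * g x" if "x \<in> X" for x
  \<comment> \<open>Separation gives the inequality only strictly above the graph; the slack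
    \<open>e / (a + b)\<close> in both coordinates costs exactly \<open>e\<close>.\<close>
  proof (rule field_le_epsilon)
    fix e :: real assume "e > 0"
    then have "e / (a + b) > 0"
      using pos by simp
    from sep[OF that this this] have "0 \<le> a * f x + b * g x + (a + b) * (e / (a + b))"
      by (simp only: algebra_simps)
    then show "0 \<le> a * f x + b * g x + e"
      using pos by simp
  qed
  have "0 \<le> a / (a + b) * f x + b / (a + b) * g x" if "x \<in> X" for x
  proof -
    have "0 \<le> (a * f x + b * g x) / (a + b)"
      using nonneg[OF that] pos by simp
    then show ?thesis
      by (simp add: add_divide_distrib)
  qed
  moreover have "a / (a + b) \<ge> 0" "b / (a + b) \<ge> 0" "a / (a + b) + b / (a + b) = 1"
    using \<open>a \<ge> 0\<close> \<open>b \<ge> 0\<close> pos by (auto simp flip: add_divide_distrib)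
  ultimately show ?thesis
    by blast
qed

text \<open>Induction on the index set reduces to two functions. Where \<open>f i\<close> is
  negative, the remaining functions satisfy the hypothesis, so the induction hypothesis, applied on
  that smaller convex set, combines them into one function \<open>g\<close>. Then \<open>f i\<close>
  and \<open>g\<close> are never both negative.\<close>

lemma convex_alternative:
  fixes f :: "'i \<Rightarrow> 'a::real_vector \<Rightarrow> real"
  assumes "finite I" "I \<noteq> {}" "\<And>i. i \<in> I \<Longrightarrow> convex_on X (f i)"
    and "\<And>x. x \<in> X \<Longrightarrow> \<exists>i\<in>I. f i x \<ge> 0"
  shows "\<exists>l. (\<forall>i\<in>I. 0 \<le> l i) \<and> sum l I = 1 \<and> (\<forall>x\<in>X. 0 \<le> (\<Sum>i\<in>I. l i * f i x))"
  using assms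
proof (induction I arbitrary: X rule: finite_ne_induct)
  case (singleton i)
  then show ?case by (intro exI[of _ "\<lambda>_. 1"]) auto
next
  case (insert i I)
  have convX: "convex X"
    using insert.prems(1) convex_on_imp_convex by blast
  define X' where "X' = {x \<in> X. f i x < 0}"
  have "convex X'"
  proof (rule convexI)
    fix x y and u v :: real
    assume *: "x \<in> X'" "y \<in> X'" "0 \<le> u" "0 \<le> v" "u + v = 1"
    then have "f i (u *\<^sub>R x + v *\<^sub>R y) \<le> u * f i x + v * f i y"
      using insert.prems(1)[of i] by (auto simp: convex_on_def X'_def)
    also have "\<dots> < 0"
      using * convex_bound_lt[of "f i x" 0 "f i y" u v] by (auto simp: X'_def)
    finally show "u *\<^sub>R x + v *\<^sub>R y \<in> X'"
      using * convX by (auto simp: X'_def convexD)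
  qed
  then have "\<exists>l. (\<forall>i\<in>I. 0 \<le> l i) \<and> sum l I = 1 \<and> (\<forall>x\<in>X'. 0 \<le> (\<Sum>i\<in>I. l i * f i x))"
    using insert.prems by (intro insert.IH) (fastforce simp: X'_def intro: convex_on_subset)+
  then obtain l where l: "\<And>i. i \<in> I \<Longrightarrow> 0 \<le> l i" "sum l I = 1"
    "\<And>x. x \<in> X' \<Longrightarrow> 0 \<le> (\<Sum>i\<in>I. l i * f i x)"
    by blast
  define g where "g x = (\<Sum>i\<in>I. l i * f i x)" for x
  have "convex_on X g"
    unfolding g_def using insert l convX by (intro convex_on_weighted_sum) auto
  moreover have "f i x \<ge> 0 \<or> g x \<ge> 0" if "x \<in> X" for x
    using l(3)[of x] that by (cases "f i x < 0") (auto simp: X'_def g_def)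
  ultimately obtain a b where ab: "a \<ge> 0" "b \<ge> 0" "a + b = 1"
    "\<And>x. x \<in> X \<Longrightarrow> 0 \<le> a * f i x + b * g x"
    using convex_alternative_pair[of X "f i" g] insert.prems(1) by blast
  define m where "m j = (if j = i then a else b * l j)" for j
  have m: "(\<Sum>j\<in>insert i I. m j * h j) = a * h i + b * (\<Sum>j\<in>I. l j * h j)" for h
  proof -
    have "(\<Sum>j\<in>I. m j * h j) = (\<Sum>j\<in>I. b * (l j * h j))"
      using insert.hyps by (intro sum.cong) (auto simp: m_def)
    then show ?thesis
      using insert.hyps by (simp add: m_def sum_distrib_left)
  qed
  show ?case
    using m[of "\<lambda>_. 1"] m[of "\<lambda>j. f j _"] ab l by (intro exI[of _ m]) (auto simp: m_def g_def)
qed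

section \<open>Separability and the supremum distance\<close>

lemma countable_dense_subset:
  assumes T: "separable_space (subtopology (mtopology_of m) K)" and S: "S \<subseteq> K" "S \<subseteq> mspace m"
  obtains D where "countable D" "D \<subseteq> S" "\<And>s e. s \<in> S \<Longrightarrow> 0 < e \<Longrightarrow> \<exists>t\<in>D. mdist m s t < e"
proof -
  interpret Metric_space "mspace m" "mdist m"
    by (rule Metric_space_mspace_mdist)
  obtain A where A: "countable A" "A \<subseteq> mspace m"
    "subtopology mtopology K closure_of A = topspace (subtopology mtopology K)"
    using T unfolding separable_space_def mtopology_of_def by auto
  have near: "\<exists>a\<in>A. mdist m s a < e" if "s \<in> S" "e > 0" for s e
  proof -
    have "s \<in> mtopology closure_of A"
      using A(3) S that(1) closure_of_subtopology_subset[of mtopology K A] by auto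
    then show ?thesis
      using that(2) unfolding metric_closure_of by auto
  qed
  \<comment> \<open>The dense set \<open>A\<close> may miss \<open>S\<close>, so each of its points
    is replaced by nearby points of \<open>S\<close>, one for each tolerance where possible.
    Intersecting with \<open>S\<close> discards arbitrary values of \<open>SOME\<close> outside
    \<open>S\<close>.\<close>
  define near_pt where "near_pt = (\<lambda>(a, k). SOME t. t \<in> S \<and> mdist m a t < 1 / real (Suc k))"
  define D where "D = near_pt ` (A \<times> UNIV) \<inter> S"
  show thesis
  proof (rule that[of D])
    show "countable D" "D \<subseteq> S"
      using A(1) by (auto simp: D_def)
    fix s and e :: real assume s: "s \<in> S" and e: "0 < e"
    then obtain k where k: "1 / real (Suc k) < e / 2"
      using nat_approx_posE[of "e/2"] by auto
    obtain a where a: "a \<in> A" "mdist m s a < 1 / real (Suc k)"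
      using near[OF s, of "1 / real (Suc k)"] by auto
    have "\<exists>t. t \<in> S \<and> mdist m a t < 1 / real (Suc k)"
      using s a commute by auto
    then have t: "near_pt (a, k) \<in> S \<and> mdist m a (near_pt (a, k)) < 1 / real (Suc k)"
      unfolding near_pt_def prod.case by (rule someI_ex)
    then have "mdist m s (near_pt (a, k)) \<le> mdist m s a + mdist m a (near_pt (a, k))"
      using S s a A(2) by (intro triangle) auto
    then have "mdist m s (near_pt (a, k)) < e"
      using t a k by linarith
    moreover have "near_pt (a, k) \<in> D"
      using t a by (auto simp: D_def)
    ultimately show "\<exists>t\<in>D. mdist m s t < e"
      by blast
  qed
qed

lemma mspace_linf: "f \<in> mspace (linf X) \<longleftrightarrow> f \<in> extensional X \<and> bounded (f ` X)"
  by (auto simp: linf_def Metric_space.fspace_def[OF Met_TC.Metric_space_axioms])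

lemma abs_diff_le_mdist_linf:
  assumes "f \<in> mspace (linf X)" "g \<in> mspace (linf X)" "x \<in> X"
  shows "\<bar>f x - g x\<bar> \<le> mdist (linf X) f g"
proof -
  have fg: "f \<in> Met_TC.fspace X" "g \<in> Met_TC.fspace X"
    using assms by (auto simp: linf_def)
  have "dist (f x) (g x) \<le> (SUP u\<in>X. dist (f u) (g u))"
    using assms(3) by (intro cSUP_upper Met_TC.bdd_above_dist[OF fg]) auto
  then show ?thesis
    using assms(3) fg by (auto simp: linf_def Met_TC.fdist_def dist_real_def)
qed

text \<open>Each \<open>f\<close> is its own one-term combination, since points of
  \<open>linf X\<close> are already \<open>undefined\<close> off \<open>X\<close>. Separability of
  the closed span thereby reaches the generating family.\<close>

lemma subset_linf_closed_span:
  assumes "S \<subseteq> mspace (linf X)"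
  shows "S \<subseteq> linf_closed_span X S"
proof -
  have "S \<subseteq> linf_span X S"
  proof
    fix f assume f: "f \<in> S"
    then have "f = (\<lambda>x\<in>X. \<Sum>g\<in>{f}. 1 * g x)"
      using assms by (auto simp: mspace_linf fun_eq_iff extensional_def)
    then show "f \<in> linf_span X S"
      unfolding linf_span_def using f by (intro CollectI exI[of _ "{f}"] exI[of _ "\<lambda>_. 1"]) auto
  qed
  then show ?thesis
    unfolding linf_closed_span_def using assms
    by (metis closure_of_mono closure_of_subset order_trans topspace_mtopology_of)
qed

theorem corollary3:
  fixes X :: "'v::{topological_real_vector, t2_space} set"
    and Y :: "'y set"
    and H L :: "'v \<Rightarrow> 'y \<Rightarrow> real"
  assumes "Y \<noteq> {}"
    and "invariant_infinite_convex_combinations X"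
    and H_bounded: "bounded ((\<lambda>(x, y). H x y) ` (X \<times> Y))"
    and H_convex: "\<And>y. y \<in> Y \<Longrightarrow> convex_on X (\<lambda>x. H x y)"
    and H_homogeneous: "\<And>c x y. c > 0 \<Longrightarrow> x \<in> X \<Longrightarrow> c *\<^sub>R x \<in> X \<Longrightarrow> y \<in> Y \<Longrightarrow>
          H (c *\<^sub>R x) y = c * H x y"
    and H_attains: "\<And>x. x \<in> X \<Longrightarrow> \<exists>y\<^sub>x\<in>Y. ereal (H x y\<^sub>x) = (SUP y\<in>Y. ereal (H x y))"
    and H_separable: "separable_space (subtopology (mtopology_of (linf X))
          (linf_closed_span X ((\<lambda>y. \<lambda>x\<in>X. H x y) ` Y)))"
    and L_concave: "supinf_concave X Y L"
    and H_le_L: "\<And>x y. x \<in> X \<Longrightarrow> y \<in> Y \<Longrightarrow> H x y \<le> L x y"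
  shows "(INF x\<in>X. SUP y\<in>Y. ereal (H x y)) \<le> (SUP y\<in>Y. INF x\<in>X. ereal (L x y))"
proof (cases "X = {}")
  \<comment> \<open>Both sides are infinite: the infima are over the empty set and \<open>Y\<close>
    is nonempty.\<close>
  case True
  then show ?thesis
    using assms(1) by simp
next
  case False
  obtain M where M: "\<And>x y. x \<in> X \<Longrightarrow> y \<in> Y \<Longrightarrow> \<bar>H x y\<bar> \<le> M"
    using H_bounded unfolding bounded_iff by fastforce
  have attains: "\<exists>y\<in>Y. \<forall>y'\<in>Y. H x y' \<le> H x y" if "x \<in> X" for x
    using H_attains[OF that] by (metis SUP_upper ereal_less_eq(3))
  show ?thesis
  proof (rule ccontr)
    assume "\<not> ?thesis"
    then obtain c' where c': "(SUP y\<in>Y. INF x\<in>X. ereal (L x y)) < ereal c'"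
      "ereal c' < (INF x\<in>X. SUP y\<in>Y. ereal (H x y))"
      using ereal_dense2 by (meson not_le)
    \<comment> \<open>The gap \<open>c' - c\<close> pays for two errors, half each: the one in
      Simons' inequality and the approximation of \<open>h y\<close> by a member of the dense
      sequence.\<close>
    obtain c where c: "(SUP y\<in>Y. INF x\<in>X. ereal (L x y)) < ereal c" "c < c'"
      using ereal_dense2[OF c'(1)] by auto
    define h where "h y = (\<lambda>x\<in>X. H x y)" for y
    have h_linf: "h ` Y \<subseteq> mspace (linf X)"
    proof (clarsimp simp: mspace_linf h_def)
      fix y assume "y \<in> Y"
      then show "bounded ((\<lambda>x. H x y) ` X)"
        using M by (auto simp: bounded_iff)
    qed
    obtain D where D: "countable D" "D \<subseteq> h ` Y"
      "\<And>s e. s \<in> h ` Y \<Longrightarrow> 0 < e \<Longrightarrow> \<exists>t\<in>D. mdist (linf X) s t < e"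
      using countable_dense_subset[OF H_separable[folded h_def] subset_linf_closed_span[OF h_linf] h_linf]
      by blast
    have "D \<noteq> {}"
      using D(3)[of _ 1] assms(1) by fastforce
    then obtain g :: "nat \<Rightarrow> 'v \<Rightarrow> real" where g: "range g = D"
      using range_from_nat_into[OF _ D(1)] by blast
    \<comment> \<open>The shift matches the index range \<open>{1..n}\<close> of supinf-concavity:
      \<open>g k\<close> is represented by \<open>d (Suc k)\<close>.\<close>
    have "\<forall>i. \<exists>y\<in>Y. g (i - 1) = h y"
      using g D(2) by blast
    then obtain d where d: "\<And>i. d i \<in> Y" "\<And>i. g (i - 1) = h (d i)"
      by metis
    define C where "C n = {x \<in> X. \<forall>i\<in>{1..n}. H x (d i) \<le> c}" for n
    have C_nonempty: "C n \<noteq> {}" for n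
    proof (cases "n = 0")
      case True
      then show ?thesis using False by (simp add: C_def)
    next
      case n: False
      show ?thesis
      proof
        assume "C n = {}"
        then have "\<exists>i\<in>{1..n}. \<not> H x (d i) \<le> c" if "x \<in> X" for x
          using that unfolding C_def by blast
        \<comment> \<open>The alternative yields weights for which the average of the
          \<open>H x (d i)\<close> is at least \<open>c\<close> on all of \<open>X\<close>. The same
          then holds for \<open>L\<close>, against supinf-concavity.\<close>
        then have pos: "\<exists>i\<in>{1..n}. 0 \<le> H x (d i) + (- c)" if "x \<in> X" for x
          using that by force
        have index: "finite {1..n}" "{1..n} \<noteq> {}"
          using n by auto
        have shifted: "convex_on X (\<lambda>x. H x (d i) + (- c))" for i
          by (intro convex_on_add H_convex d(1))
            (simp add: convex_on_const convex_on_imp_convex[OF H_convex[OF d(1)]])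
        obtain l where l: "\<And>i. i \<in> {1..n} \<Longrightarrow> 0 \<le> l i" "sum l {1..n} = 1"
          "\<And>x. x \<in> X \<Longrightarrow> 0 \<le> (\<Sum>i=1..n. l i * (H x (d i) + (- c)))"
          using convex_alternative[of "{1..n}" X "\<lambda>i x. H x (d i) + (- c)", OF index shifted pos]
          by blast
        have "c \<le> (\<Sum>i=1..n. l i * L x (d i))" if "x \<in> X" for x
        proof -
          have "(\<Sum>i=1..n. l i * (H x (d i) + (- c))) = (\<Sum>i=1..n. l i * H x (d i)) + sum l {1..n} * (- c)"
            unfolding sum_distrib_right by (simp only: distrib_left sum.distrib)
          then have "c \<le> (\<Sum>i=1..n. l i * H x (d i))"
            using l(3)[OF that] l(2) by simp
          also have "\<dots> \<le> (\<Sum>i=1..n. l i * L x (d i))"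
            using l(1) H_le_L[OF that d(1)] by (intro sum_mono mult_left_mono) auto
          finally show ?thesis .
        qed
        \<comment> \<open>The restrictions make \<open>d\<close> and \<open>l\<close> extensional,
          as the index set of the supremum demands.\<close>
        then have "ereal c \<le> (INF x\<in>X. ereal (\<Sum>i=1..n. restrict l {1..n} i * L x (restrict d {1..n} i)))"
          by (intro INF_greatest) simp
        also have "\<dots> \<le> (SUP (n, y, l) \<in> (SIGMA n:{1::nat..}. ({1..n} \<rightarrow>\<^sub>E Y) \<times> std_simplex n).
            INF x\<in>X. ereal (\<Sum>i=1..n. l i * L x (y i)))"
          using n d(1) l(1,2)
          by (intro SUP_upper2[of "(n, restrict d {1..n}, restrict l {1..n})"])
            (auto simp: std_simplex_def)
        also have "\<dots> < ereal c"
          using c(1) L_concave by (simp add: supinf_concave_def)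
        finally show False by simp
      qed
    qed
    obtain v y where v: "v \<in> X" and y: "y \<in> Y" "\<And>y'. y' \<in> Y \<Longrightarrow> H v y' \<le> H v y"
      and w: "\<And>n. \<exists>w\<in>C n. H v y \<le> H w y + (c' - c) / 2"
    proof (rule simons_inequality[of Y X H M C "(c' - c) / 2"])
      show "invariant_infinite_convex_combinations (C n)" for n
        unfolding C_def using M[OF _ d(1)]
        by (intro invariant_convex_sublevel[OF assms(2), where M = M] H_convex d(1)) (auto simp: abs_le_iff)
      show "decseq C"
        unfolding decseq_def C_def by auto
    qed (use assms(1) False H_convex M attains C_nonempty c(2) in \<open>auto simp: C_def\<close>)
    have "ereal c' < (SUP y\<in>Y. ereal (H v y))"
      using c'(2) v by (meson INF_lower less_le_trans)
    also have "\<dots> \<le> ereal (H v y)"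
      using y by (intro SUP_least) simp
    finally have c'_less: "c' < H v y"
      by simp
    obtain k where "mdist (linf X) (h y) (g k) < (c' - c) / 2"
      using D(3)[of "h y" "(c' - c) / 2"] y(1) c(2) g by auto
    then have k: "mdist (linf X) (h y) (h (d (Suc k))) < (c' - c) / 2"
      using d(2)[of "Suc k"] by simp
    obtain w0 where w0: "w0 \<in> C (Suc k)" "H v y \<le> H w0 y + (c' - c) / 2"
      using w by blast
    then have w0X: "w0 \<in> X" and "H w0 (d (Suc k)) \<le> c"
      by (auto simp: C_def)
    moreover have "\<bar>h y w0 - h (d (Suc k)) w0\<bar> \<le> mdist (linf X) (h y) (h (d (Suc k)))"
      using h_linf y(1) d(1) w0X by (intro abs_diff_le_mdist_linf) auto
    then have "H w0 y - H w0 (d (Suc k)) < (c' - c) / 2"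
      using k w0X by (simp add: h_def)
    \<comment> \<open>The chain is \<open>H v y \<le> H w0 y + (c' - c) / 2 < H w0 (d (Suc k)) + (c'
      - c) \<le> c'\<close>, against \<open>c' < H v y\<close>.\<close>
    ultimately show False
      using c'_less w0(2) c(2) by argo
  qed
qed

end
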